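(* There exist finite, simple, unweighted geodetic graphs $G$ of diameter two such that for every drawing $\varphi$ of $G$ in $\mathbb{R}^2$ there are two shortest paths $P_1,P_2$ in $G$ whose curves $\varphi(P_1)$ and $\varphi(P_2)$ meet more than once.
   Context: A graph is geodetic if between every pair of vertices there is a unique shortest path (edges unweighted). A drawing $\varphi$ of a graph $G$ in $\mathbb{R}^2$ maps the vertices to pairwise distinct points and each edge to a Jordan arc between the images of its two end-vertices that is disjoint from the image of every other vertex. For a path $P=v_1,\dots,v_n$ in $G$, $\varphi(P)$ denotes the arc obtained by concatenating the curves $\varphi(v_1v_2),\dots,\varphi(v_{n-1}v_n)$. For two curves $\gamma_1,\gamma_2:[0,1]\to\mathbb{R}^2$, a meet is a pair of maximal intervals $I_1,I_2\subseteq[0,1]$ together with a bijection $\iota:I_1\to I_2$ such that $\gamma_1(x)=\gamma_2(\iota(x))$ for all $x\in I_1$; the curves meet $k$ times if they have $k$ pairwise distinct meets. *)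

theory Defs
  imports "HOL-Analysis.Analysis" "HOL-Library.FuncSet"
begin

definition simple_graph :: "'a set \<Rightarrow> 'a set set \<Rightarrow> bool" where
  "simple_graph V E \<longleftrightarrow> (\<forall>e\<in>E. e \<subseteq> V \<and> card e = 2)"

text \<open>Paths are vertex lists, so an undirected path is represented by a list and by its reverse.\<close>

definition graph_path :: "'a set \<Rightarrow> 'a set set \<Rightarrow> 'a \<Rightarrow> 'a \<Rightarrow> 'a list \<Rightarrow> bool" where
  "graph_path V E u v p \<longleftrightarrow>
     p \<noteq> [] \<and> hd p = u \<and> last p = v \<and> set p \<subseteq> V \<and> distinct p \<and>
     successively (\<lambda>x y. {x, y} \<in> E) p"

definition shortest_path :: "'a set \<Rightarrow> 'a set set \<Rightarrow> 'a \<Rightarrow> 'a \<Rightarrow> 'a list \<Rightarrow> bool" where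
  "shortest_path V E u v p \<longleftrightarrow>
     graph_path V E u v p \<and> (\<forall>q. graph_path V E u v q \<longrightarrow> length p \<le> length q)"

definition geodetic :: "'a set \<Rightarrow> 'a set set \<Rightarrow> bool" where
  "geodetic V E \<longleftrightarrow> (\<forall>u\<in>V. \<forall>v\<in>V. \<exists>!p. shortest_path V E u v p)"

text \<open>The number of edges of a path is one less than the length of its vertex list. The two
  definitions below are meaningful for finite, nonempty, connected graphs only.\<close>

definition graph_dist :: "'a set \<Rightarrow> 'a set set \<Rightarrow> 'a \<Rightarrow> 'a \<Rightarrow> nat" where
  "graph_dist V E u v = (LEAST n. \<exists>p. graph_path V E u v p \<and> length p = Suc n)"

definition graph_diameter :: "'a set \<Rightarrow> 'a set set \<Rightarrow> nat" where
  "graph_diameter V E = Max {graph_dist V E u v | u v. u \<in> V \<and> v \<in> V}"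

text \<open>A drawing consists of a map \<open>pt\<close> on vertices and a map \<open>crv\<close> assigning to each
  (undirected) edge an arc, parametrised in either direction.\<close>

definition drawing ::
    "'a set \<Rightarrow> 'a set set \<Rightarrow> ('a \<Rightarrow> real^2) \<Rightarrow> ('a set \<Rightarrow> real \<Rightarrow> real^2) \<Rightarrow> bool" where
  "drawing V E pt crv \<longleftrightarrow>
     inj_on pt V \<and>
     (\<forall>e\<in>E. arc (crv e) \<and> {pathstart (crv e), pathfinish (crv e)} = pt ` e \<and>
            (\<forall>w\<in>V - e. pt w \<notin> path_image (crv e)))"

definition edge_curve ::
    "('a \<Rightarrow> real^2) \<Rightarrow> ('a set \<Rightarrow> real \<Rightarrow> real^2) \<Rightarrow> 'a \<Rightarrow> 'a \<Rightarrow> real \<Rightarrow> real^2" where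
  "edge_curve pt crv u v =
     (if pathstart (crv {u, v}) = pt u then crv {u, v} else reversepath (crv {u, v}))"

text \<open>Deliberately unspecified for paths without edges.\<close>

fun path_curve ::
    "('a \<Rightarrow> real^2) \<Rightarrow> ('a set \<Rightarrow> real \<Rightarrow> real^2) \<Rightarrow> 'a list \<Rightarrow> real \<Rightarrow> real^2" where
  "path_curve pt crv [u, v] = edge_curve pt crv u v"
| "path_curve pt crv (u # v # w # ws) = edge_curve pt crv u v +++ path_curve pt crv (v # w # ws)"

text \<open>Intervals are nonempty and may be single points; a transversal crossing is a pair of
  one-point intervals.\<close>

definition common_part ::
    "(real \<Rightarrow> 'b) \<Rightarrow> (real \<Rightarrow> 'b) \<Rightarrow> real set \<Rightarrow> real set \<Rightarrow> (real \<Rightarrow> real) \<Rightarrow> bool" where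
  "common_part \<gamma>1 \<gamma>2 I1 I2 \<iota> \<longleftrightarrow>
     is_interval I1 \<and> I1 \<noteq> {} \<and> I1 \<subseteq> {0..1} \<and>
     is_interval I2 \<and> I2 \<noteq> {} \<and> I2 \<subseteq> {0..1} \<and>
     bij_betw \<iota> I1 I2 \<and> (\<forall>x\<in>I1. \<gamma>1 x = \<gamma>2 (\<iota> x))"

text \<open>The bijection is taken in \<^const>\<open>extensional\<close>, so that its irrelevant values outside
  of \<open>I1\<close> do not produce several meets out of one.\<close>

definition meets ::
    "(real \<Rightarrow> 'b) \<Rightarrow> (real \<Rightarrow> 'b) \<Rightarrow> (real set \<times> real set \<times> (real \<Rightarrow> real)) set" where
  "meets \<gamma>1 \<gamma>2 =
     {(I1, I2, \<iota>). common_part \<gamma>1 \<gamma>2 I1 I2 \<iota> \<and> \<iota> \<in> extensional I1 \<and>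
        (\<forall>J1 J2 \<kappa>. common_part \<gamma>1 \<gamma>2 J1 J2 \<kappa> \<and> I1 \<subseteq> J1 \<and> I2 \<subseteq> J2 \<longrightarrow> J1 = I1 \<and> J2 = I2)}"

definition meet_times :: "(real \<Rightarrow> 'b) \<Rightarrow> (real \<Rightarrow> 'b) \<Rightarrow> nat \<Rightarrow> bool" where
  "meet_times \<gamma>1 \<gamma>2 k \<longleftrightarrow> (\<exists>M. M \<subseteq> meets \<gamma>1 \<gamma>2 \<and> finite M \<and> card M = k)"

end

theory Submission
  imports Defs "HOL-Complex_Analysis.Winding_Numbers"
begin

text \<open>
  The Petersen graph is geodetic of diameter two and every path with two edges is a shortest path.
  Suppose that no two shortest paths meet twice. Two edges \<open>ab\<close>, \<open>bx\<close> then share the point of \<open>b\<close> only,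
  as any further common point is visited twice by the path \<open>abx\<close>, which gives it two meets with the
  path \<open>bx\<close>. Two disjoint edges \<open>ab\<close>, \<open>cd\<close> do not intersect: if \<open>bc\<close> is an edge, then \<open>abc\<close> and \<open>cd\<close>
  meet already in \<open>c\<close>, and otherwise, in terms of the common neighbour \<open>x\<close> of \<open>b\<close> and \<open>c\<close>, the paths
  \<open>abx\<close> and \<open>xcd\<close> meet already in \<open>x\<close>. Hence the drawing is plane, but the Petersen graph contains
  a subdivision of $K_{3,3}$.

  For the nonplanarity of $K_{3,3}$, let three arcs join \<open>a\<close> to \<open>b\<close>. By additivity of winding numbers,
  a point off the arcs lies inside either none or exactly two of the three Jordan curves that they form.
  A point joined to interior points of all three arcs, without crossing the other two, contradicts
  the Jordan curve theorem in both cases.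
\<close>

section \<open>Theta curves\<close>

text \<open>Both arcs run from \<open>a\<close> to \<open>b\<close>, so the Jordan curve is
  \<open>c\<close> followed by the reverse of \<open>d\<close>. Three arcs that pairwise form a
  bigon make a theta curve.\<close>

definition bigon :: "'a::topological_space \<Rightarrow> 'a \<Rightarrow> (real \<Rightarrow> 'a) \<Rightarrow> (real \<Rightarrow> 'a) \<Rightarrow> bool" where
  "bigon a b c d \<longleftrightarrow> arc c \<and> arc d \<and> pathstart c = a \<and> pathfinish c = b \<and>
     pathstart d = a \<and> pathfinish d = b \<and> path_image c \<inter> path_image d = {a, b}"

lemma bigon_sym: "bigon a b c d \<Longrightarrow> bigon a b d c"
  by (auto simp: bigon_def)

lemma bigon_loop:
  assumes "bigon a b c d"
  shows "simple_path (c +++ reversepath d)"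
    and "pathfinish (c +++ reversepath d) = pathstart (c +++ reversepath d)"
    and "path_image (c +++ reversepath d) = path_image c \<union> path_image d"
  using assms by (auto simp: bigon_def path_image_join arc_reversepath intro!: simple_path_join_loop)

lemma bigon_Jordan:
  fixes c d :: "real \<Rightarrow> complex"
  assumes "bigon a b c d"
  defines "S \<equiv> path_image c \<union> path_image d"
  shows "inside S \<noteq> {}" "connected (inside S)" "connected (outside S)"
    "bounded (inside S)" "\<not> bounded (outside S)"
    "frontier (inside S) = S" "frontier (outside S) = S" "open (outside S)"
  using Jordan_inside_outside[OF bigon_loop(1,2)[OF assms(1)]]
  unfolding bigon_loop(3)[OF assms(1)] S_def by auto

text \<open>The winding number of the loop \<open>c +++ reversepath d\<close> is the difference of
  those of \<open>c\<close> and \<open>d\<close>; for a simple closed curve it is 1 or -1 inside and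
  0 outside.\<close>

lemma bigon_winding_number:
  fixes c d :: "real \<Rightarrow> complex"
  assumes "bigon a b c d"
  defines "S \<equiv> path_image c \<union> path_image d"
  shows "z \<in> inside S \<Longrightarrow> winding_number c z - winding_number d z \<in> {1, -1}"
    and "z \<in> outside S \<Longrightarrow> winding_number c z = winding_number d z"
proof -
  let ?g = "c +++ reversepath d"
  note loop = bigon_loop[OF assms(1), folded S_def]
  have wn: "winding_number ?g z = winding_number c z - winding_number d z" if "z \<notin> S"
    using assms that
    by (simp add: bigon_def winding_number_join winding_number_reversepath arc_imp_path)
  show "winding_number c z - winding_number d z \<in> {1, -1}" if z: "z \<in> inside S"
  proof -
    have "z \<notin> S" using z inside_no_overlap by blast
    show ?thesis
      using simple_closed_path_winding_number_inside[OF loop(1)] z wn[OF \<open>z \<notin> S\<close>] loop(3)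
      by (metis insertCI)
  qed
  show "winding_number c z = winding_number d z" if z: "z \<in> outside S"
  proof -
    have "z \<notin> S" using z outside_no_overlap by blast
    moreover have "winding_number ?g z = 0"
      using winding_number_zero_in_outside[of ?g z] loop z simple_path_imp_path by metis
    ultimately show ?thesis using wn by simp
  qed
qed

text \<open>The difference for \<open>c1\<close> and \<open>c3\<close> is the sum of those for
  \<open>c1\<close>, \<open>c2\<close> and for \<open>c2\<close>, \<open>c3\<close>. The first
  summand is 1 or -1, so exactly one of the other two differences vanishes: two terms from {1, -1}
  never add up to 1 or -1.\<close>

lemma theta_inside_cases:
  fixes c1 c2 c3 :: "real \<Rightarrow> complex"
  assumes "bigon a b c1 c2" "bigon a b c1 c3" "bigon a b c2 c3"
    and z: "z \<notin> path_image c1 \<union> path_image c2 \<union> path_image c3"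
    and i: "z \<in> inside (path_image c1 \<union> path_image c2)"
  shows "z \<in> inside (path_image c1 \<union> path_image c3) \<longleftrightarrow>
         z \<in> outside (path_image c2 \<union> path_image c3)"
proof -
  have *: "z \<in> inside T \<longleftrightarrow> z \<notin> outside T" if "z \<notin> T" for T
    using that inside_Un_outside[of T] inside_Int_outside[of T] by blast
  have sum: "u + v \<notin> {1, -1}" if "u \<in> {1, -1}" "v \<in> {1, -1}" for u v :: complex
    using that by auto
  note 12 = bigon_winding_number[OF assms(1)]
  note 13 = bigon_winding_number[OF assms(2)]
  note 23 = bigon_winding_number[OF assms(3)]
  have a: "winding_number c1 z - winding_number c2 z \<in> {1, -1}" using 12(1) i .
  show ?thesis
  proof
    assume "z \<in> inside (path_image c1 \<union> path_image c3)"
    then have b: "winding_number c1 z - winding_number c3 z \<in> {1, -1}" using 13(1) by blast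
    show "z \<in> outside (path_image c2 \<union> path_image c3)"
    proof (rule ccontr)
      assume "z \<notin> outside (path_image c2 \<union> path_image c3)"
      then have "winding_number c2 z - winding_number c3 z \<in> {1, -1}"
        using 23(1) * z by blast
      from sum[OF a this] b show False by simp
    qed
  next
    assume "z \<in> outside (path_image c2 \<union> path_image c3)"
    then have b: "winding_number c2 z = winding_number c3 z" using 23(2) by blast
    show "z \<in> inside (path_image c1 \<union> path_image c3)"
    proof (rule ccontr)
      assume "z \<notin> inside (path_image c1 \<union> path_image c3)"
      then have "winding_number c1 z = winding_number c3 z"
        using 13(2) * z by blast
      with a b show False by auto
    qed
  qed
qed

lemma connected_subset_inside:
  assumes "connected T" "T \<inter> S = {}" "x \<in> T" "x \<in> inside S"
  shows "T \<subseteq> inside S"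
  using inside_outside_intersect_connected[of T S] assms inside_Un_outside[of S] by blast

lemma connected_subset_outside:
  assumes "connected T" "T \<inter> S = {}" "x \<in> T" "x \<in> outside S"
  shows "T \<subseteq> outside S"
  using inside_outside_intersect_connected[of T S] assms inside_Un_outside[of S] by blast

text \<open>Without its end points the third arc is connected and misses the Jordan curve, so a
  single point decides the side.\<close>

lemma theta_third_arc_inside:
  assumes "bigon a b c1 c2" "bigon a b c1 c3" "bigon a b c2 c3"
    and "q \<in> path_image c3 - {a, b}" "q \<in> inside (path_image c1 \<union> path_image c2)"
  shows "path_image c3 - {a, b} \<subseteq> inside (path_image c1 \<union> path_image c2)"
  using assms connected_simple_path_endless[of c3]
  by (intro connected_subset_inside[of _ _ q]) (auto simp: bigon_def arc_imp_simple_path)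

lemma theta_third_arc_outside:
  assumes "bigon a b c1 c2" "bigon a b c1 c3" "bigon a b c2 c3"
    and "q \<in> path_image c3 - {a, b}" "q \<in> outside (path_image c1 \<union> path_image c2)"
  shows "path_image c3 - {a, b} \<subseteq> outside (path_image c1 \<union> path_image c2)"
  using assms connected_simple_path_endless[of c3]
  by (intro connected_subset_outside[of _ _ q]) (auto simp: bigon_def arc_imp_simple_path)

text \<open>With \<open>c3\<close> inside the curve of \<open>c1\<close> and \<open>c2\<close>, the
  outside of that curve is a connected set that misses \<open>c1\<close> and \<open>c3\<close>.
  Being unbounded, it does not fit into the bounded inside of their curve.\<close>

lemma theta_outside_subset:
  fixes c1 c2 c3 :: "real \<Rightarrow> complex"
  assumes t: "bigon a b c1 c2" "bigon a b c1 c3" "bigon a b c2 c3"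
    and "q \<in> path_image c3 - {a, b}" "q \<in> inside (path_image c1 \<union> path_image c2)"
  shows "outside (path_image c1 \<union> path_image c2) \<subseteq> outside (path_image c1 \<union> path_image c3)"
proof -
  let ?O = "outside (path_image c1 \<union> path_image c2)" and ?S = "path_image c1 \<union> path_image c3"
  have "a \<in> path_image c1" "b \<in> path_image c1" using t by (auto simp: bigon_def)
  then have disj: "?O \<inter> ?S = {}"
    using theta_third_arc_inside[OF assms] outside_no_overlap[of "path_image c1 \<union> path_image c2"]
      inside_Int_outside[of "path_image c1 \<union> path_image c2"] by blast
  have "\<not> ?O \<subseteq> inside ?S"
    using bigon_Jordan(5)[OF t(1)] bigon_Jordan(4)[OF t(2)] bounded_subset by blast
  then show ?thesis
    using connected_subset_inside[OF bigon_Jordan(3)[OF t(1)] disj] disj inside_Un_outside[of ?S]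
    by blast
qed

text \<open>Applied in both directions, the previous lemma makes the two outsides equal. Their
  frontiers, the two Jordan curves, would then be equal too, although \<open>q3\<close> lies on one
  of them only.\<close>

lemma theta_not_both_inside:
  fixes c1 c2 c3 :: "real \<Rightarrow> complex"
  assumes t: "bigon a b c1 c2" "bigon a b c1 c3" "bigon a b c2 c3"
    and q3: "q3 \<in> path_image c3 - {a, b}" "q3 \<in> inside (path_image c1 \<union> path_image c2)"
    and q2: "q2 \<in> path_image c2 - {a, b}" "q2 \<in> inside (path_image c1 \<union> path_image c3)"
  shows False
proof -
  have "outside (path_image c1 \<union> path_image c2) = outside (path_image c1 \<union> path_image c3)"
    using theta_outside_subset[OF t q3] theta_outside_subset[OF t(2,1) bigon_sym[OF t(3)] q2] 
    by blast
  then have "path_image c1 \<union> path_image c2 = path_image c1 \<union> path_image c3"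
    using bigon_Jordan(7)[OF t(1)] bigon_Jordan(7)[OF t(2)] by metis
  then show False using q3 q2 t by (auto simp: bigon_def)
qed

text \<open>As \<open>c3\<close> runs outside, the region bounded by \<open>c1\<close> and
  \<open>c2\<close> misses the curve of \<open>c2\<close> and \<open>c3\<close>. If it met the
  inside of this curve, it would be contained in it, and its closure could not reach the outside.
  But \<open>q1\<close> is on its frontier.\<close>

lemma theta_inside_not_subset:
  fixes c1 c2 c3 :: "real \<Rightarrow> complex"
  assumes t: "bigon a b c1 c2" "bigon a b c1 c3" "bigon a b c2 c3"
    and q1: "q1 \<in> path_image c1 - {a, b}" "q1 \<in> outside (path_image c2 \<union> path_image c3)"
    and q3: "q3 \<in> path_image c3 - {a, b}" "q3 \<in> outside (path_image c1 \<union> path_image c2)"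
    and x: "x \<in> inside (path_image c1 \<union> path_image c2)"
  shows "x \<notin> inside (path_image c2 \<union> path_image c3)"
proof
  let ?I = "inside (path_image c1 \<union> path_image c2)" and ?J = "inside (path_image c2 \<union> path_image c3)"
  assume xJ: "x \<in> ?J"
  have "a \<in> path_image c1" "b \<in> path_image c1" using t by (auto simp: bigon_def)
  then have "?I \<inter> (path_image c2 \<union> path_image c3) = {}"
    using theta_third_arc_outside[OF t q3] inside_no_overlap[of "path_image c1 \<union> path_image c2"]
      inside_Int_outside[of "path_image c1 \<union> path_image c2"] by blast
  then have "?I \<subseteq> ?J"
    using connected_subset_inside[OF bigon_Jordan(2)[OF t(1)]] x xJ by blast
  then have "closure ?I \<inter> outside (path_image c2 \<union> path_image c3) = {}"
    using open_Int_closure_eq_empty[OF bigon_Jordan(8)[OF t(3)], of ?I]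
      inside_Int_outside[of "path_image c2 \<union> path_image c3"] by blast
  moreover have "q1 \<in> closure ?I"
    using q1(1) bigon_Jordan(6)[OF t(1)] by (auto simp: closure_Un_frontier)
  ultimately show False using q1(2) by blast
qed

text \<open>Only the topological content of the nonplanarity of $K_{3,3}$ is kept: the third vertex of the
  class of \<open>a\<close> and \<open>b\<close> is \<open>p\<close>, and \<open>D\<^sub>i\<close> plays the role of its edge to \<open>q\<^sub>i\<close>.\<close>

lemma K33_not_in_complex_plane:
  fixes c1 c2 c3 :: "real \<Rightarrow> complex"
  assumes t: "bigon a b c1 c2" "bigon a b c1 c3" "bigon a b c2 c3"
    and q1: "q1 \<in> path_image c1 - {a, b}" and q2: "q2 \<in> path_image c2 - {a, b}"
    and q3: "q3 \<in> path_image c3 - {a, b}"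
    and D1: "connected D1" "p \<in> D1" "q1 \<in> D1" "D1 \<inter> (path_image c2 \<union> path_image c3) = {}"
    and D2: "connected D2" "p \<in> D2" "q2 \<in> D2" "D2 \<inter> (path_image c1 \<union> path_image c3) = {}"
    and D3: "connected D3" "p \<in> D3" "q3 \<in> D3" "D3 \<inter> (path_image c1 \<union> path_image c2) = {}"
  shows False
proof -
  note t' = bigon_sym[OF t(1)] bigon_sym[OF t(2)] bigon_sym[OF t(3)]
  let ?S12 = "path_image c1 \<union> path_image c2" and ?S13 = "path_image c1 \<union> path_image c3"
    and ?S23 = "path_image c2 \<union> path_image c3"
  have p: "p \<notin> path_image c1 \<union> path_image c2 \<union> path_image c3"
    using D1 D2 D3 by blast
  \<comment> \<open>Each \<open>D_i\<close> joins \<open>p\<close> to \<open>q_i\<close> without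
    crossing the Jordan curve of the other two arcs.\<close>
  have sides: "p \<in> inside ?S12 \<Longrightarrow> q3 \<in> inside ?S12" "p \<in> outside ?S12 \<Longrightarrow> q3 \<in> outside ?S12"
     "p \<in> inside ?S13 \<Longrightarrow> q2 \<in> inside ?S13" "p \<in> outside ?S13 \<Longrightarrow> q2 \<in> outside ?S13"
     "p \<in> inside ?S23 \<Longrightarrow> q1 \<in> inside ?S23" "p \<in> outside ?S23 \<Longrightarrow> q1 \<in> outside ?S23"
    using connected_subset_inside[OF D1(1,4,2)] connected_subset_outside[OF D1(1,4,2)]
      connected_subset_inside[OF D2(1,4,2)] connected_subset_outside[OF D2(1,4,2)]
      connected_subset_inside[OF D3(1,4,2)] connected_subset_outside[OF D3(1,4,2)]
      D1(3) D2(3) D3(3) by blast+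
  have io: "z \<in> inside T \<or> z \<in> outside T" if "z \<notin> T" for z :: complex and T
    using that inside_Un_outside[of T] by blast
  \<comment> \<open>The point \<open>p\<close> is inside at most one of the three curves, but inside
    one implies inside a second. Hence \<open>p\<close>, and with it every \<open>q_i\<close>, is
    outside of all three.\<close>
  have "\<not> (p \<in> inside ?S12 \<and> p \<in> inside ?S13)"
    using theta_not_both_inside[OF t q3 _ q2] sides by blast
  moreover have "\<not> (p \<in> inside ?S12 \<and> p \<in> inside ?S23)"
    using theta_not_both_inside[OF t'(1) t(3,2) q3 _ q1] sides by (auto simp: Un_commute)
  moreover have "\<not> (p \<in> inside ?S13 \<and> p \<in> inside ?S23)"
    using theta_not_both_inside[OF t'(2,3) t(1) q2 _ q1] sides by (auto simp: Un_commute)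
  moreover have "p \<in> inside ?S12 \<Longrightarrow> p \<in> inside ?S13 \<or> p \<in> inside ?S23"
    using theta_inside_cases[OF t p] io[of p ?S23] p by blast
  moreover have "p \<in> inside ?S13 \<Longrightarrow> p \<in> inside ?S12 \<or> p \<in> inside ?S23"
    using theta_inside_cases[OF t(2,1) t'(3), of p] io[of p ?S23] p by (auto simp: Un_commute)
  moreover have "p \<in> inside ?S23 \<Longrightarrow> p \<in> inside ?S12 \<or> p \<in> inside ?S13"
    using theta_inside_cases[OF t(3) t'(1,2), of p] io[of p ?S13] p by (auto simp: Un_commute)
  ultimately have "p \<notin> inside ?S12" "p \<notin> inside ?S13" "p \<notin> inside ?S23"
    by argo+
  then have out: "p \<in> outside ?S12" "p \<in> outside ?S13" "p \<in> outside ?S23"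
    using io[of p ?S12] io[of p ?S13] io[of p ?S23] p by auto
  \<comment> \<open>It remains to refute that each arc runs outside the curve of the other two. A
    point \<open>x\<close> inside one curve would be inside neither of the others, against
    \<open>theta_inside_cases\<close>.\<close>
  obtain x where x: "x \<in> inside ?S12"
    using bigon_Jordan(1)[OF t(1)] by blast
  have "x \<notin> inside ?S23"
    using theta_inside_not_subset[OF t q1 _ q3 _ x] sides out by blast
  moreover have "x \<notin> inside ?S13"
    using theta_inside_not_subset[OF t'(1) t(3,2) q2 _ q3 _, of x] sides out x by (auto simp: Un_commute)
  moreover have "x \<notin> path_image c1 \<union> path_image c2 \<union> path_image c3"
  proof -
    have "x \<notin> ?S12" using x inside_no_overlap by blast
    moreover have "path_image c3 - {a, b} \<subseteq> outside ?S12"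
      using theta_third_arc_outside[OF t q3] sides out by blast
    moreover have "a \<in> path_image c1" "b \<in> path_image c1" using t by (auto simp: bigon_def)
    ultimately show ?thesis using x inside_Int_outside[of ?S12] by blast
  qed
  ultimately show False
    using theta_inside_cases[OF t _ x] io[of x ?S23] by blast
qed

text \<open>Winding numbers concern curves in \<open>complex\<close>, whereas drawings live in
  \<open>real^2\<close>. Linearity and injectivity carry arcs, connected sets and intersections
  across.\<close>

definition complex_of_plane :: "real^2 \<Rightarrow> complex" where
  "complex_of_plane v = Complex (vec_nth v 1) (vec_nth v 2)"

lemma linear_complex_of_plane: "linear complex_of_plane"
  by (auto simp: complex_of_plane_def complex_eq_iff intro!: linearI)

lemma inj_complex_of_plane: "inj complex_of_plane"
  by (auto simp: complex_of_plane_def inj_def vec_eq_iff forall_2)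

lemma bigon_complex_of_plane:
  assumes "bigon a b c d"
  shows "bigon (complex_of_plane a) (complex_of_plane b) (complex_of_plane \<circ> c) (complex_of_plane \<circ> d)"
proof -
  have "complex_of_plane ` path_image c \<inter> complex_of_plane ` path_image d = complex_of_plane ` {a, b}"
    using assms by (simp add: bigon_def inj_complex_of_plane flip: image_Int)
  then show ?thesis
    using assms
    by (simp add: bigon_def arc_linear_image_eq linear_complex_of_plane inj_complex_of_plane
        pathstart_compose pathfinish_compose path_image_compose)
qed

lemma K33_not_in_plane:
  fixes c1 c2 c3 :: "real \<Rightarrow> real^2"
  assumes t: "bigon a b c1 c2" "bigon a b c1 c3" "bigon a b c2 c3"
    and q1: "q1 \<in> path_image c1 - {a, b}" and q2: "q2 \<in> path_image c2 - {a, b}"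
    and q3: "q3 \<in> path_image c3 - {a, b}"
    and D1: "connected D1" "p \<in> D1" "q1 \<in> D1" "D1 \<inter> (path_image c2 \<union> path_image c3) = {}"
    and D2: "connected D2" "p \<in> D2" "q2 \<in> D2" "D2 \<inter> (path_image c1 \<union> path_image c3) = {}"
    and D3: "connected D3" "p \<in> D3" "q3 \<in> D3" "D3 \<inter> (path_image c1 \<union> path_image c2) = {}"
  shows False
proof -
  let ?h = complex_of_plane
  note h = linear_complex_of_plane inj_complex_of_plane
  have c: "connected (?h ` D)" if "connected D" for D
    using that connected_linear_image h(1) by blast
  have d: "?h ` D \<inter> (?h ` X \<union> ?h ` Y) = {}" if "D \<inter> (X \<union> Y) = {}" for D X Y
    using that h(2) by (auto simp: inj_eq)
  show ?thesis
    using K33_not_in_complex_plane[OF t[THEN bigon_complex_of_plane], of "?h q1" "?h q2" "?h q3"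
        "?h ` D1" "?h p" "?h ` D2" "?h ` D3"] q1 q2 q3 D1 D2 D3 c d[OF D1(4)] d[OF D2(4)] d[OF D3(4)]
    by (auto simp: path_image_compose inj_eq[OF h(2)] image_iff)
qed

section \<open>Meets of curves\<close>

lemma chain_pair_upper:
  assumes "subset.chain A C" "X \<in> C" "Y \<in> C"
  obtains Z where "Z \<in> C" "X \<subseteq> Z" "Y \<subseteq> Z"
proof -
  have "X \<subseteq> Y \<or> Y \<subseteq> X" using assms by (simp add: subset_chain_def)
  then show ?thesis using assms(2,3) that[of X] that[of Y] by auto
qed

lemma is_interval_Union_chain:
  fixes C :: "real set set"
  assumes "subset.chain A C" "\<And>X. X \<in> C \<Longrightarrow> is_interval X"
  shows "is_interval (\<Union>C)"
proof -
  have "x \<in> \<Union>C" if XY: "X \<in> C" "Y \<in> C" and x: "a \<in> X" "b \<in> Y" "a \<le> x" "x \<le> b" for X Y a b x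
  proof -
    obtain Z where "Z \<in> C" "X \<subseteq> Z" "Y \<subseteq> Z"
      using chain_pair_upper[OF assms(1) XY] .
    then show ?thesis
      using x assms(2)[of Z] unfolding is_interval_1 by (meson UnionI subsetD)
  qed
  then show ?thesis unfolding is_interval_1 by blast
qed

lemma inj_on_Union_chain:
  assumes "subset.chain A C" "\<And>X. X \<in> C \<Longrightarrow> inj_on f X"
  shows "inj_on f (\<Union>C)"
proof (rule inj_onI)
  fix x y assume "x \<in> \<Union>C" "y \<in> \<Union>C" "f x = f y"
  then obtain X Y where "X \<in> C" "Y \<in> C" "x \<in> X" "y \<in> Y" by blast
  then obtain Z where "Z \<in> C" "x \<in> Z" "y \<in> Z"
    using chain_pair_upper[OF assms(1)] by (metis subsetD)
  then show "x = y" using assms(2) \<open>f x = f y\<close> by (meson inj_onD)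
qed

text \<open>Injectivity of \<open>\<gamma>2\<close> forces \<open>\<iota>\<close> to be its inverse
  after \<open>\<gamma>1\<close>, which expresses the whole common part through
  \<open>I1\<close>.\<close>

lemma common_part_injD:
  assumes "common_part \<gamma>1 \<gamma>2 I1 I2 \<iota>" "inj_on \<gamma>2 {0..1}"
  shows "inj_on \<gamma>1 I1" "\<gamma>1 ` I1 \<subseteq> \<gamma>2 ` {0..1}" "\<And>x. x \<in> I1 \<Longrightarrow> \<iota> x = inv_into {0..1} \<gamma>2 (\<gamma>1 x)"
    "I2 = (\<lambda>x. inv_into {0..1} \<gamma>2 (\<gamma>1 x)) ` I1"
proof -
  have b: "bij_betw \<iota> I1 I2" and e: "\<And>x. x \<in> I1 \<Longrightarrow> \<gamma>1 x = \<gamma>2 (\<iota> x)"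
    and s: "I2 \<subseteq> {0..1}" and i: "inj_on \<iota> I1"
    using assms(1) by (auto simp: common_part_def bij_betw_def)
  have m: "\<iota> x \<in> {0..1}" if "x \<in> I1" for x
    using b s that bij_betwE by blast
  show "inj_on \<gamma>1 I1"
  proof (rule inj_onI)
    fix x y assume xy: "x \<in> I1" "y \<in> I1" "\<gamma>1 x = \<gamma>1 y"
    then have "\<gamma>2 (\<iota> x) = \<gamma>2 (\<iota> y)" using e by simp
    then have "\<iota> x = \<iota> y" using inj_onD[OF assms(2)] m xy(1,2) by blast
    then show "x = y" using inj_onD[OF i] xy(1,2) by blast
  qed
  show "\<gamma>1 ` I1 \<subseteq> \<gamma>2 ` {0..1}" using e m by blast
  show eq: "\<iota> x = inv_into {0..1} \<gamma>2 (\<gamma>1 x)" if "x \<in> I1" for x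
    by (simp only: e[OF that] inv_into_f_f[OF assms(2) m[OF that]])
  show "I2 = (\<lambda>x. inv_into {0..1} \<gamma>2 (\<gamma>1 x)) ` I1"
    using b image_cong[OF refl eq, of I1] by (simp add: bij_betw_def)
qed

text \<open>If \<open>\<gamma>2\<close> is injective, the bijection of a common part is determined by its first interval, so
  the common parts form an inductive order.\<close>

lemma common_part_extends_to_meet:
  assumes cp: "common_part \<gamma>1 \<gamma>2 I1 I2 \<iota>" and inj: "inj_on \<gamma>2 {0..1}"
  obtains J1 J2 \<kappa> where "(J1, J2, \<kappa>) \<in> meets \<gamma>1 \<gamma>2" "I1 \<subseteq> J1"
proof -
  define \<phi> where "\<phi> = (\<lambda>x. inv_into {0..1} \<gamma>2 (\<gamma>1 x))"
  \<comment> \<open>The possible first intervals of common parts extending \<open>I1\<close>; all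
    conditions pass to unions of chains, so Zorn's lemma applies.\<close>
  define \<A> where "\<A> = {J. I1 \<subseteq> J \<and> is_interval J \<and> J \<subseteq> {0..1} \<and> is_interval (\<phi> ` J) \<and>
      inj_on \<gamma>1 J \<and> \<gamma>1 ` J \<subseteq> \<gamma>2 ` {0..1}}"
  have mem: "J1 \<in> \<A> \<and> J2 = \<phi> ` J1" if "common_part \<gamma>1 \<gamma>2 J1 J2 \<kappa>" "I1 \<subseteq> J1" for J1 J2 \<kappa>
  proof -
    have "J2 = \<phi> ` J1" using common_part_injD(4)[OF that(1) inj] by (simp add: \<phi>_def)
    moreover have "is_interval J1" "J1 \<subseteq> {0..1}" "is_interval J2"
      using that(1) by (simp_all add: common_part_def)
    ultimately show ?thesis
      using common_part_injD(1,2)[OF that(1) inj] that(2) by (simp add: \<A>_def)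
  qed
  have "\<exists>M\<in>\<A>. \<forall>X\<in>\<A>. M \<subseteq> X \<longrightarrow> X = M"
  proof (rule subset_Zorn_nonempty)
    show "\<A> \<noteq> {}" using mem[OF cp] by blast
    fix C assume C: "C \<noteq> {}" "subset.chain \<A> C"
    then have CA: "C \<subseteq> \<A>" by (simp add: subset.chain_def)
    \<comment> \<open>The images under \<open>\<phi>\<close> again form a chain, so the second
      interval of the union is an interval as well.\<close>
    have ch: "subset.chain ((`) \<phi> ` \<A>) ((`) \<phi> ` C)"
      using C(2) unfolding subset_chain_def by (simp add: image_mono) (meson image_mono)
    have "is_interval (\<Union>C)" using is_interval_Union_chain[OF C(2)] CA by (auto simp: \<A>_def)
    moreover have "is_interval (\<phi> ` \<Union>C)"
      using is_interval_Union_chain[OF ch] CA by (auto simp: \<A>_def image_Union)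
    moreover have "inj_on \<gamma>1 (\<Union>C)" using inj_on_Union_chain[OF C(2)] CA by (auto simp: \<A>_def)
    moreover have "I1 \<subseteq> \<Union>C" using C(1) CA unfolding \<A>_def by blast
    ultimately show "\<Union>C \<in> \<A>" using CA unfolding \<A>_def by blast
  qed
  then obtain M where M: "M \<in> \<A>" "\<And>X. X \<in> \<A> \<Longrightarrow> M \<subseteq> X \<Longrightarrow> X = M" by blast
  then have sub: "I1 \<subseteq> M" and inM: "inj_on \<gamma>1 M" and imM: "\<gamma>1 ` M \<subseteq> \<gamma>2 ` {0..1}"
    by (auto simp: \<A>_def)
  \<comment> \<open>On \<open>M\<close> the value of \<open>inv_into\<close> is a genuine preimage,
    since \<open>\<gamma>1\<close> maps \<open>M\<close> into the image of
    \<open>\<gamma>2\<close>.\<close>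
  have "\<gamma>2 (\<phi> x) = \<gamma>1 x" "\<phi> x \<in> {0..1}" if "x \<in> M" for x
  proof -
    have "\<gamma>1 x \<in> \<gamma>2 ` {0..1}" using imM that by blast
    then show "\<gamma>2 (\<phi> x) = \<gamma>1 x" "\<phi> x \<in> {0..1}"
      unfolding \<phi>_def by (rule f_inv_into_f, rule inv_into_into)
  qed
  then have \<phi>: "\<And>x. x \<in> M \<Longrightarrow> \<gamma>2 (\<phi> x) = \<gamma>1 x" "\<phi> ` M \<subseteq> {0..1}" by auto
  have "inj_on \<phi> M" using inM \<phi>(1) by (metis inj_on_def)
  moreover have "I1 \<noteq> {}" using cp by (simp add: common_part_def)
  ultimately have cpM: "common_part \<gamma>1 \<gamma>2 M (\<phi> ` M) (restrict \<phi> M)"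
    using M(1) \<phi> sub unfolding common_part_def \<A>_def by (auto simp: bij_betw_def inj_on_restrict_eq)
  have max: "J1 = M \<and> J2 = \<phi> ` M" if "common_part \<gamma>1 \<gamma>2 J1 J2 \<kappa>" "M \<subseteq> J1" for J1 J2 \<kappa>
    using mem[OF that(1)] M(2)[of J1] sub that by auto
  have "(M, \<phi> ` M, restrict \<phi> M) \<in> meets \<gamma>1 \<gamma>2"
    unfolding meets_def
    by (intro CollectI case_prodI conjI cpM restrict_extensional allI impI)
      (elim conjE, drule (1) max, elim conjE, assumption)+
  then show ?thesis using sub that by blast
qed

text \<open>Each of the two common points lies in some meet. If it were the same meet, its interval
  would contain \<open>{s..s'}\<close>, and there \<open>\<gamma>1\<close> would be injective with
  values on \<open>\<gamma>2\<close>. The assumption \<open>sep\<close> denies this and also forces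
  \<open>s \<le> s'\<close>, as it fails for an empty interval.\<close>

lemma meet_twice:
  assumes inj: "inj_on \<gamma>2 {0..1}"
    and s: "s \<in> {0..1}" "\<gamma>1 s \<in> \<gamma>2 ` {0..1}" and s': "s' \<in> {0..1}" "\<gamma>1 s' \<in> \<gamma>2 ` {0..1}"
    and sep: "\<not> inj_on \<gamma>1 {s..s'} \<or> \<not> \<gamma>1 ` {s..s'} \<subseteq> \<gamma>2 ` {0..1}"
  shows "meet_times \<gamma>1 \<gamma>2 2"
proof -
  \<comment> \<open>A single common point is a common part with one-point intervals, and it extends
    to a meet.\<close>
  have pt: "\<exists>m \<in> meets \<gamma>1 \<gamma>2. x \<in> fst m" if x: "x \<in> {0..1}" "\<gamma>1 x \<in> \<gamma>2 ` {0..1}" for x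
  proof -
    obtain t where "t \<in> {0..1}" "\<gamma>1 x = \<gamma>2 t" using x by blast
    then have "common_part \<gamma>1 \<gamma>2 {x} {t} (\<lambda>_. t)"
      using x by (auto simp: common_part_def bij_betw_def is_interval_1)
    from common_part_extends_to_meet[OF this inj] show ?thesis by (metis fst_conv insert_subset)
  qed
  obtain m m' where m: "m \<in> meets \<gamma>1 \<gamma>2" "s \<in> fst m" and m': "m' \<in> meets \<gamma>1 \<gamma>2" "s' \<in> fst m'"
    using pt[OF s] pt[OF s'] by blast
  have "m \<noteq> m'"
  proof
    assume "m = m'"
    obtain I1 I2 \<iota> where [simp]: "m = (I1, I2, \<iota>)" by (cases m)
    have cp: "common_part \<gamma>1 \<gamma>2 I1 I2 \<iota>" using m by (simp add: meets_def)
    then have "is_interval I1" by (simp add: common_part_def)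
    then have "{s..s'} \<subseteq> I1"
      using m(2) m'(2) \<open>m = m'\<close> by (auto simp: is_interval_1)
    then show False
      using common_part_injD(1,2)[OF cp inj] sep by (meson image_mono inj_on_subset order_trans)
  qed
  then show ?thesis
    using m m' by (auto simp: meet_times_def intro!: exI[of _ "{m, m'}"])
qed

section \<open>Concatenated curves that meet another curve twice\<close>

lemma path_image_join_first_half:
  assumes "y \<in> path_image g"
  obtains s where "0 \<le> s" "s \<le> 1/2" "(g +++ h) s = y"
proof -
  obtain r where "0 \<le> r" "r \<le> 1" "g r = y" using assms by (auto simp: path_image_def)
  then show ?thesis using that[of "r/2"] by (auto simp: joinpaths_def)
qed

lemma joinpaths_half: "(g +++ h) (1/2) = pathfinish g"
  by (simp add: joinpaths_def pathfinish_def)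

text \<open>The concatenation visits \<open>y\<close> once along \<open>g\<close> and once more
  along \<open>h\<close>, so it is not injective between the two parameters.\<close>

lemma joinpaths_meet_twice_second_half:
  assumes "arc h" "pathfinish g = pathstart h" "y \<in> path_image g" "y \<in> path_image h" "y \<noteq> pathstart h"
  shows "meet_times (g +++ h) h 2"
proof -
  obtain s where s: "0 \<le> s" "s \<le> 1/2" "(g +++ h) s = y"
    using assms path_image_join_first_half by blast
  obtain t where t: "0 \<le> t" "t \<le> 1" "h t = y" using assms by (auto simp: path_image_def)
  \<comment> \<open>Positivity puts the second visit strictly after the joint at parameter 1/2,
    hence after the first visit.\<close>
  have "t > 0" using t assms by (cases "t = 0") (auto simp: pathstart_def)
  then have t2: "(g +++ h) ((1 + t) / 2) = y" using t by (simp add: joinpaths_def add_divide_distrib)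
  have "s \<in> {s..(1 + t) / 2}" "(1 + t) / 2 \<in> {s..(1 + t) / 2}" "s \<noteq> (1 + t) / 2"
    using s t \<open>t > 0\<close> by auto
  then have "\<not> inj_on (g +++ h) {s..(1 + t) / 2}" using s(3) t2 by (metis inj_onD)
  moreover have "inj_on h {0..1}" "y \<in> h ` {0..1}"
    using assms(1,4) by (simp_all add: arc_def path_image_def)
  ultimately show ?thesis
    using meet_twice[of h s "g +++ h" "(1 + t) / 2"] s t(1,2) t2 by simp
qed

text \<open>Between \<open>y\<close> and the end of \<open>h\<close> the concatenation passes the
  joint, which is off \<open>k\<close>.\<close>

lemma joinpaths_meet_twice_end:
  assumes "arc k" "y \<in> path_image g" "y \<in> path_image k"
    and "pathfinish g \<notin> path_image k" "pathfinish h \<in> path_image k"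
  shows "meet_times (g +++ h) k 2"
proof -
  obtain s where s: "0 \<le> s" "s \<le> 1/2" "(g +++ h) s = y"
    using assms path_image_join_first_half by blast
  have "(g +++ h) 1 = pathfinish h" by (simp add: joinpaths_def pathfinish_def)
  moreover have "\<not> (g +++ h) ` {s..1} \<subseteq> k ` {0..1}"
  proof -
    have "1/2 \<in> {s..1}" using s by simp
    then show ?thesis
      using assms(4) joinpaths_half[of g h] unfolding path_image_def by (metis image_subset_iff)
  qed
  moreover have "inj_on k {0..1}" "y \<in> k ` {0..1}" "pathfinish h \<in> k ` {0..1}"
    using assms(1,3,5) by (simp_all add: arc_def path_image_def)
  ultimately show ?thesis
    using meet_twice[of k s "g +++ h" 1] s by simp
qed

section \<open>Geodetic graphs without triangles\<close>

fun path_edges :: "'a list \<Rightarrow> 'a set set" where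
  "path_edges (u # v # p) = insert {u, v} (path_edges (v # p))"
| "path_edges _ = {}"

lemma Union_path_edges_subset: "\<Union>(path_edges p) \<subseteq> set p"
  by (induction p rule: path_edges.induct) auto

lemma Union_path_edges: "length p > 1 \<Longrightarrow> \<Union>(path_edges p) = set p"
proof (induction p rule: path_edges.induct)
  case (1 u v p)
  then show ?case by (cases p) auto
qed simp_all

lemma path_edges_subset: "successively (\<lambda>x y. {x, y} \<in> E) p \<Longrightarrow> path_edges p \<subseteq> E"
  by (induction p rule: path_edges.induct) auto

text \<open>The two conditions make every path with two edges and distinct ends the unique shortest
  one, and they bound the distances by two. Being finite statements about adjacency, they can be
  checked by evaluation.\<close>

locale triangle_free_geodetic =
  fixes V :: "'a set" and E :: "'a set set"
  assumes simple: "simple_graph V E"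
    and triangle_free: "{a, b} \<in> E \<Longrightarrow> {b, c} \<in> E \<Longrightarrow> {a, c} \<notin> E"
    and common_neighbour: "u \<in> V \<Longrightarrow> v \<in> V \<Longrightarrow> u \<noteq> v \<Longrightarrow> {u, v} \<notin> E \<Longrightarrow>
      \<exists>!w. {u, w} \<in> E \<and> {w, v} \<in> E"
begin

lemma edgeD: "{u, v} \<in> E \<Longrightarrow> u \<in> V \<and> v \<in> V \<and> u \<noteq> v"
  using simple by (auto simp: simple_graph_def)

lemma edge_cases:
  assumes "e \<in> E"
  obtains u v where "e = {u, v}" "u \<noteq> v"
  using assms simple by (auto simp: simple_graph_def card_2_iff)

lemma graph_path_length:
  assumes "graph_path V E u v p"
  shows "length p > 0" "u \<noteq> v \<Longrightarrow> length p > 1" "u \<noteq> v \<Longrightarrow> {u, v} \<notin> E \<Longrightarrow> length p > 2"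
proof -
  show "length p > 0" using assms by (auto simp: graph_path_def)
  show "length p > 1" if "u \<noteq> v"
    using assms that by (cases p; cases "tl p") (auto simp: graph_path_def)
  then show "length p > 2" if "u \<noteq> v" "{u, v} \<notin> E"
    using assms that by (cases p; cases "tl p"; cases "tl (tl p)") (auto simp: graph_path_def)
qed

lemma shortest_path_self_iff: "u \<in> V \<Longrightarrow> shortest_path V E u u p \<longleftrightarrow> p = [u]"
proof
  assume u: "u \<in> V"
  have g: "graph_path V E u u [u]" using u by (simp add: graph_path_def)
  show "p = [u]" if "shortest_path V E u u p"
  proof -
    have "length p \<le> 1" "graph_path V E u u p" using that g by (auto simp: shortest_path_def)
    then show ?thesis by (cases p) (auto simp: graph_path_def)
  qed
  show "shortest_path V E u u p" if "p = [u]"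
    using that g graph_path_length(1) by (auto simp: shortest_path_def Suc_le_eq)
qed

lemma shortest_path_edge_iff: "{u, v} \<in> E \<Longrightarrow> shortest_path V E u v p \<longleftrightarrow> p = [u, v]"
proof
  assume e: "{u, v} \<in> E"
  have g: "graph_path V E u v [u, v]" using e edgeD[OF e] by (simp add: graph_path_def)
  show "p = [u, v]" if "shortest_path V E u v p"
  proof -
    have p: "length p \<le> 2" "graph_path V E u v p" using that g by (auto simp: shortest_path_def)
    moreover have "length p > 1" using graph_path_length(2)[OF p(2)] edgeD[OF e] by blast
    ultimately show ?thesis by (cases p; cases "tl p") (auto simp: graph_path_def)
  qed
  show "shortest_path V E u v p" if "p = [u, v]"
    using that g graph_path_length(2) edgeD[OF e] by (fastforce simp: shortest_path_def)
qed

text \<open>The absence of triangles excludes the edge between \<open>u\<close> and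
  \<open>v\<close>, so three vertices are needed; the middle one is the unique common
  neighbour.\<close>

lemma shortest_path_two_iff:
  assumes e: "{u, w} \<in> E" "{w, v} \<in> E" and "u \<noteq> v"
  shows "shortest_path V E u v p \<longleftrightarrow> p = [u, w, v]"
proof
  have ne: "{u, v} \<notin> E" using triangle_free[OF e] .
  have g: "graph_path V E u v [u, w, v]"
    using e edgeD[OF e(1)] edgeD[OF e(2)] \<open>u \<noteq> v\<close> by (simp add: graph_path_def)
  show "p = [u, w, v]" if "shortest_path V E u v p"
  proof -
    have p: "length p \<le> 3" "graph_path V E u v p" using that g by (auto simp: shortest_path_def)
    moreover have "length p > 2" using graph_path_length(3)[OF p(2)] ne \<open>u \<noteq> v\<close> by blast
    ultimately have "length p = 3" by simp
    then obtain x y z where xyz: "p = [x, y, z]"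
      by (auto simp: length_Suc_conv numeral_3_eq_3)
    have "x = u" "z = v" "{u, y} \<in> E" "{y, v} \<in> E" using p(2) xyz by (auto simp: graph_path_def)
    moreover have "y = w"
      using common_neighbour[of u v] e edgeD[OF e(1)] edgeD[OF e(2)] ne \<open>u \<noteq> v\<close> calculation by blast
    ultimately show ?thesis using xyz by simp
  qed
  show "shortest_path V E u v p" if "p = [u, w, v]"
    using that g graph_path_length(3) ne \<open>u \<noteq> v\<close> by (fastforce simp: shortest_path_def)
qed

lemma shortest_path_cases:
  assumes "u \<in> V" "v \<in> V"
  obtains "u = v" | "{u, v} \<in> E" "u \<noteq> v"
  | w where "u \<noteq> v" "{u, v} \<notin> E" "{u, w} \<in> E" "{w, v} \<in> E"
  using assms common_neighbour edgeD by metis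

lemma geodetic: "geodetic V E"
  unfolding geodetic_def
proof (intro ballI)
  fix u v assume "u \<in> V" "v \<in> V"
  then show "\<exists>!p. shortest_path V E u v p"
    using shortest_path_self_iff[OF \<open>v \<in> V\<close>]
    by (cases rule: shortest_path_cases) (simp_all add: shortest_path_edge_iff shortest_path_two_iff)
qed

lemma graph_dist_shortest_path:
  assumes "shortest_path V E u v p"
  shows "graph_dist V E u v = length p - 1"
  unfolding graph_dist_def
proof (rule Least_equality)
  show "\<exists>q. graph_path V E u v q \<and> length q = Suc (length p - 1)"
    using assms graph_path_length(1) by (intro exI[of _ p]) (auto simp: shortest_path_def)
  show "length p - 1 \<le> n" if "\<exists>q. graph_path V E u v q \<and> length q = Suc n" for n
    using assms that by (fastforce simp: shortest_path_def)
qed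

lemma graph_diameter_eq_2:
  assumes "a \<in> V" "b \<in> V" "a \<noteq> b" "{a, b} \<notin> E"
  shows "graph_diameter V E = 2"
proof -
  let ?D = "{graph_dist V E u v | u v. u \<in> V \<and> v \<in> V}"
  have le: "graph_dist V E u v \<le> 2" if "u \<in> V" "v \<in> V" for u v
    using that
  proof (cases rule: shortest_path_cases)
    case 1
    then show ?thesis using graph_dist_shortest_path[of u v "[u]"] that
      by (simp add: shortest_path_self_iff)
  next
    case 2
    then show ?thesis using graph_dist_shortest_path[of u v "[u, v]"]
      by (simp add: shortest_path_edge_iff)
  next
    case (3 w)
    then show ?thesis using graph_dist_shortest_path[of u v "[u, w, v]"]
      by (simp add: shortest_path_two_iff)
  qed
  obtain w where "{a, w} \<in> E" "{w, b} \<in> E" using common_neighbour assms by blast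
  then have "graph_dist V E a b = 2"
    using graph_dist_shortest_path[of a b "[a, w, b]"] assms(3) by (simp add: shortest_path_two_iff)
  then have "2 \<in> ?D" using assms by force
  moreover have "?D \<subseteq> {..2}" using le by auto
  ultimately show ?thesis
    unfolding graph_diameter_def
    by (intro Max_eqI) (auto intro: finite_subset)
qed

end

section \<open>Drawings in which shortest paths meet at most once\<close>

locale drawn_graph = triangle_free_geodetic +
  fixes pt :: "'a \<Rightarrow> real^2" and crv :: "'a set \<Rightarrow> real \<Rightarrow> real^2"
  assumes drawn: "drawing V E pt crv"
begin

abbreviation img :: "'a set \<Rightarrow> (real^2) set" where
  "img e \<equiv> path_image (crv e)"

abbreviation pc :: "'a list \<Rightarrow> real \<Rightarrow> real^2" where
  "pc \<equiv> path_curve pt crv"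

abbreviation ec :: "'a \<Rightarrow> 'a \<Rightarrow> real \<Rightarrow> real^2" where
  "ec \<equiv> edge_curve pt crv"

lemma pt_eq_iff: "u \<in> V \<Longrightarrow> v \<in> V \<Longrightarrow> pt u = pt v \<longleftrightarrow> u = v"
  using drawn by (auto simp: drawing_def inj_on_eq_iff)

lemma pt_in_img: "w \<in> V \<Longrightarrow> e \<in> E \<Longrightarrow> pt w \<in> img e \<Longrightarrow> w \<in> e"
  using drawn by (auto simp: drawing_def)

lemma edge_curve:
  assumes "{u, v} \<in> E"
  shows "arc (ec u v)" "pathstart (ec u v) = pt u" "pathfinish (ec u v) = pt v"
    "path_image (ec u v) = img {u, v}"
proof -
  have "arc (crv {u, v})" "{pathstart (crv {u, v}), pathfinish (crv {u, v})} = {pt u, pt v}"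
    using drawn assms by (auto simp: drawing_def)
  \<comment> \<open>Distinct end points settle which orientation \<open>edge_curve\<close>
    picks.\<close>
  moreover have "pt u \<noteq> pt v" using edgeD[OF assms] pt_eq_iff by blast
  ultimately show "arc (ec u v)" "pathstart (ec u v) = pt u" "pathfinish (ec u v) = pt v"
    "path_image (ec u v) = img {u, v}"
    by (auto simp: edge_curve_def arc_reversepath doubleton_eq_iff)
qed

end

text \<open>The negation of the claim for a given drawing, with two meets in place of more than one.
  Paths without edges are left out because their curve is unspecified, and a reversed list is the
  same path.\<close>

locale philogeodetic_drawing = drawn_graph +
  assumes meet_once: "u1 \<noteq> v1 \<Longrightarrow> shortest_path V E u1 v1 P1 \<Longrightarrow> u2 \<noteq> v2 \<Longrightarrow>
     shortest_path V E u2 v2 P2 \<Longrightarrow> P1 \<noteq> P2 \<Longrightarrow> P1 \<noteq> rev P2 \<Longrightarrow>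
     \<not> meet_times (pc P1) (pc P2) 2"
begin

lemma adjacent_edges:
  assumes e: "{a, b} \<in> E" "{b, x} \<in> E" and "a \<noteq> x"
  shows "img {a, b} \<inter> img {b, x} \<subseteq> {pt b}"
proof (rule ccontr)
  assume "\<not> ?thesis"
  then obtain y where "y \<in> img {a, b}" "y \<in> img {b, x}" "y \<noteq> pt b" by blast
  then have "meet_times (ec a b +++ ec b x) (ec b x) 2"
    using e by (intro joinpaths_meet_twice_second_half[of _ _ y]) (auto simp: edge_curve)
  then show False
    using meet_once[of a x "[a, b, x]" b x "[b, x]"] \<open>a \<noteq> x\<close> edgeD[OF e(1)] edgeD[OF e(2)] e
    by (simp add: shortest_path_two_iff shortest_path_edge_iff)
qed

text \<open>The path \<open>abc\<close> would touch \<open>cd\<close> at \<open>y\<close>, leave it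
  at \<open>b\<close>, which the drawing keeps off \<open>cd\<close>, and return to it at
  \<open>c\<close>.\<close>

lemma edges_at_distance_1:
  assumes e: "{a, b} \<in> E" "{b, c} \<in> E" "{c, d} \<in> E" and "{a, b} \<inter> {c, d} = {}"
  shows "img {a, b} \<inter> img {c, d} = {}"
proof (rule ccontr)
  assume "\<not> ?thesis"
  then obtain y where "y \<in> img {a, b}" "y \<in> img {c, d}" by blast
  moreover have "pt b \<notin> img {c, d}" using pt_in_img[of b "{c, d}"] assms edgeD[OF e(1)] by blast
  moreover have "pt c \<in> img {c, d}" using edge_curve(2,4)[OF e(3)] pathstart_in_path_image by metis
  ultimately have "meet_times (ec a b +++ ec b c) (ec c d) 2"
    using e by (intro joinpaths_meet_twice_end[of _ y]) (auto simp: edge_curve)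
  then show False
    using meet_once[of a c "[a, b, c]" c d "[c, d]"] assms(4) edgeD[OF e(3)] e
    by (auto simp: shortest_path_two_iff shortest_path_edge_iff)
qed

text \<open>The same argument with \<open>abx\<close> against \<open>xcd\<close>: the joint
  \<open>b\<close> is off the second curve, and the end \<open>x\<close> is on it. That
  \<open>xcd\<close> is drawn as an arc comes from \<open>adjacent_edges\<close>.\<close>

lemma edges_at_distance_2:
  assumes e: "{a, b} \<in> E" "{b, x} \<in> E" "{x, c} \<in> E" "{c, d} \<in> E" and "{a, b} \<inter> {c, d} = {}"
    and x: "x \<notin> {a, b, c, d}"
  shows "img {a, b} \<inter> img {c, d} = {}"
proof (rule ccontr)
  assume "\<not> ?thesis"
  then obtain y where "y \<in> img {a, b}" "y \<in> img {c, d}" by blast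
  moreover have "arc (ec x c +++ ec c d)"
    using e x adjacent_edges[of x c d] by (intro arc_join) (auto simp: edge_curve)
  moreover have im: "path_image (ec x c +++ ec c d) = img {x, c} \<union> img {c, d}"
    using e by (simp add: path_image_join edge_curve)
  moreover have "pt b \<notin> img {c, d}" "pt b \<notin> img {x, c}"
    using pt_in_img[of b "{c, d}"] pt_in_img[of b "{x, c}"] assms edgeD[OF e(1)] by blast+
  moreover have "pt x \<in> img {x, c}" using edge_curve(2,4)[OF e(3)] pathstart_in_path_image by metis
  ultimately have "meet_times (ec a b +++ ec b x) (ec x c +++ ec c d) 2"
    using e by (intro joinpaths_meet_twice_end[of _ y]) (auto simp: edge_curve)
  then show False
    using meet_once[of a x "[a, b, x]" x d "[x, c, d]"] assms(5) x e
    by (auto simp: shortest_path_two_iff)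
qed

lemma disjoint_edges:
  assumes e: "{a, b} \<in> E" "{c, d} \<in> E" and disj: "{a, b} \<inter> {c, d} = {}"
  shows "img {a, b} \<inter> img {c, d} = {}"
proof -
  \<comment> \<open>In the last case the common neighbour \<open>x\<close> of \<open>b\<close> and
    \<open>c\<close> must differ from \<open>a\<close> and \<open>d\<close>; this is what the
    missing edges \<open>ac\<close> and \<open>bd\<close> ensure.\<close>
  consider "{b, c} \<in> E" | "{b, d} \<in> E" | "{a, c} \<in> E" | "{b, c} \<notin> E" "{b, d} \<notin> E" "{a, c} \<notin> E"
    by blast
  then show ?thesis
  proof cases
    case 1
    then show ?thesis using edges_at_distance_1[of a b c d] e disj by simp
  next
    case 2
    then show ?thesis using edges_at_distance_1[of a b d c] e disj by (simp add: insert_commute)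
  next
    case 3
    then show ?thesis using edges_at_distance_1[of b a c d] e disj by (simp add: insert_commute)
  next
    case 4
    obtain x where x: "{b, x} \<in> E" "{x, c} \<in> E"
      using common_neighbour[of b c] edgeD[OF e(1)] edgeD[OF e(2)] disj 4 by blast
    moreover have "x \<notin> {a, b, c, d}"
      using x 4 edgeD by (auto simp: insert_commute)
    ultimately show ?thesis using edges_at_distance_2[of a b x c d] e disj by simp
  qed
qed

section \<open>Planarity of the drawing and the curves of paths\<close>

lemma img_Int:
  assumes e: "e \<in> E" and f: "f \<in> E" and "e \<noteq> f"
  shows "img e \<inter> img f \<subseteq> pt ` (e \<inter> f)"
proof (cases "e \<inter> f = {}")
  case True
  obtain a b c d where "e = {a, b}" "f = {c, d}" using edge_cases e f by metis
  then show ?thesis using disjoint_edges[of a b c d] e f True by simp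
next
  case False
  then obtain b where b: "b \<in> e" "b \<in> f" by blast
  obtain a where a: "e = {a, b}" "a \<noteq> b" using edge_cases[OF e] b by (metis insert_commute insertE singletonD)
  obtain x where x: "f = {b, x}" using edge_cases[OF f] b by (metis insert_commute insertE singletonD)
  have "img e \<inter> img f \<subseteq> {pt b}" using adjacent_edges[of a b x] a x e f \<open>e \<noteq> f\<close> by auto
  then show ?thesis using b by blast
qed

lemma img_Union_Int:
  assumes "F \<subseteq> E" "G \<subseteq> E" "F \<inter> G = {}"
  shows "\<Union>(img ` F) \<inter> \<Union>(img ` G) \<subseteq> pt ` (\<Union>F \<inter> \<Union>G)"
proof
  fix y assume "y \<in> \<Union>(img ` F) \<inter> \<Union>(img ` G)"
  then obtain e f where ef: "e \<in> F" "f \<in> G" "y \<in> img e \<inter> img f" by blast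
  then have "y \<in> pt ` (e \<inter> f)" using img_Int[of e f] assms by blast
  then show "y \<in> pt ` (\<Union>F \<inter> \<Union>G)" using ef by blast
qed

text \<open>By induction: in a distinct list the first vertex is on no later edge, so by planarity
  the first edge meets the rest of the curve only at its second vertex.\<close>

lemma path_curve_walk:
  assumes "successively (\<lambda>x y. {x, y} \<in> E) p" "distinct p" "length p > 1"
  shows "arc (pc p) \<and> pathstart (pc p) = pt (hd p) \<and> pathfinish (pc p) = pt (last p) \<and>
    path_image (pc p) = \<Union>(img ` path_edges p)"
  using assms
proof (induction p rule: path_edges.induct)
  case (1 u v p)
  show ?case
  proof (cases p)
    case Nil
    then show ?thesis using 1 by (simp add: edge_curve)
  next
    case (Cons w ws)
    have uv: "{u, v} \<in> E" using 1 by simp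
    have IH: "arc (pc (v # p))" "pathstart (pc (v # p)) = pt v" "pathfinish (pc (v # p)) = pt (last p)"
      "path_image (pc (v # p)) = \<Union>(img ` path_edges (v # p))"
      using 1 Cons by auto
    have u: "u \<notin> \<Union>(path_edges (v # p))"
      using Union_path_edges_subset[of "v # p"] 1(3) by auto
    then have "\<Union>(img ` {{u, v}}) \<inter> \<Union>(img ` path_edges (v # p)) \<subseteq>
        pt ` (\<Union>{{u, v}} \<inter> \<Union>(path_edges (v # p)))"
      using uv 1(2) path_edges_subset[of E "v # p"] Cons by (intro img_Union_Int) auto
    also have "\<dots> \<subseteq> {pt v}" using u by blast
    finally have "arc (ec u v +++ pc (v # p))"
      using IH uv by (intro arc_join) (auto simp: edge_curve)
    then show ?thesis
      using IH uv Cons by (simp add: edge_curve path_image_join)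
  qed
qed simp_all

lemma path_curve:
  assumes "graph_path V E u v p" "u \<noteq> v"
  shows "arc (pc p)" "pathstart (pc p) = pt u" "pathfinish (pc p) = pt v"
    "path_image (pc p) = \<Union>(img ` path_edges p)" "path_edges p \<subseteq> E"
  using assms path_curve_walk[of p] graph_path_length(2)[OF assms] path_edges_subset[of E p]
  by (auto simp: graph_path_def)

lemma pt_in_path_curve:
  assumes "graph_path V E u v p" "u \<noteq> v" "x \<in> set p"
  shows "pt x \<in> path_image (pc p)"
proof -
  obtain e where e: "x \<in> e" "e \<in> path_edges p"
    using assms(3) Union_path_edges[OF graph_path_length(2)[OF assms(1,2)]] by blast
  then have "e \<in> E" using path_curve(5)[OF assms(1,2)] by blast
  then have "pt x \<in> img e"
    using drawn e(1) unfolding drawing_def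
    by (metis image_eqI insertE pathfinish_in_path_image pathstart_in_path_image singletonD)
  then show ?thesis using path_curve(4)[OF assms(1,2)] e by blast
qed

lemma path_curve_disjoint:
  assumes "graph_path V E u v p" "u \<noteq> v" "graph_path V E u' v' q" "u' \<noteq> v'" "set p \<inter> set q = {}"
  shows "path_image (pc p) \<inter> path_image (pc q) = {}"
proof -
  have "\<Union>(path_edges p) \<inter> \<Union>(path_edges q) = {}"
    using Union_path_edges_subset[of p] Union_path_edges_subset[of q] assms(5) by blast
  \<comment> \<open>A common edge would lie in the empty intersection of the vertex sets, which is
    absurd for a nonempty edge.\<close>
  moreover have "e \<noteq> {}" if "e \<in> path_edges p" for e
    using that path_curve(5)[OF assms(1,2)] edge_cases[of e] by auto
  ultimately have "path_edges p \<inter> path_edges q = {}"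
    by (metis Int_emptyI UnionI disjoint_iff ex_in_conv)
  then have "path_image (pc p) \<inter> path_image (pc q) \<subseteq> pt ` (\<Union>(path_edges p) \<inter> \<Union>(path_edges q))"
    using img_Union_Int path_curve(4,5)[OF assms(1,2)] path_curve(4,5)[OF assms(3,4)] by metis
  then show ?thesis using \<open>\<Union>(path_edges p) \<inter> \<Union>(path_edges q) = {}\<close> by simp
qed

text \<open>Disjointness of the edge sets is a separate condition because two paths that both
  consist of the edge \<open>uv\<close> also share exactly their ends.\<close>

lemma path_curve_bigon:
  assumes p: "graph_path V E u v p" and q: "graph_path V E u v q" and "u \<noteq> v"
    and "path_edges p \<inter> path_edges q = {}" "set p \<inter> set q = {u, v}"
  shows "bigon (pt u) (pt v) (pc p) (pc q)"
proof -
  note P = path_curve[OF p \<open>u \<noteq> v\<close>] and Q = path_curve[OF q \<open>u \<noteq> v\<close>]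
  have "path_image (pc p) \<inter> path_image (pc q) \<subseteq> pt ` (\<Union>(path_edges p) \<inter> \<Union>(path_edges q))"
    using img_Union_Int P(4,5) Q(4,5) assms(4) by metis
  also have "\<dots> \<subseteq> pt ` {u, v}"
    using Union_path_edges_subset[of p] Union_path_edges_subset[of q] assms(5) by (intro image_mono) blast
  finally have "path_image (pc p) \<inter> path_image (pc q) \<subseteq> {pt u, pt v}"
    by simp
  moreover have "pt u \<in> path_image (pc p)" "pt v \<in> path_image (pc p)"
     "pt u \<in> path_image (pc q)" "pt v \<in> path_image (pc q)"
    using P(2,3) Q(2,3) pathstart_in_path_image pathfinish_in_path_image by metis+
  ultimately show ?thesis unfolding bigon_def using P Q by blast
qed

text \<open>The classes of K33 are \<open>a\<close>, \<open>b\<close>, \<open>p\<close> and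
  \<open>q1\<close>, \<open>q2\<close>, \<open>q3\<close>. The path \<open>c_i\<close> unites the
  subdivided edges from \<open>a\<close> and from \<open>b\<close> to \<open>q_i\<close>, and
  \<open>d_i\<close> is the one from \<open>p\<close>.\<close>

lemma no_K33_subdivision:
  assumes ab: "a \<noteq> b"
    and c: "graph_path V E a b c1" "graph_path V E a b c2" "graph_path V E a b c3"
    and dist: "path_edges c1 \<inter> path_edges c2 = {}" "path_edges c1 \<inter> path_edges c3 = {}"
      "path_edges c2 \<inter> path_edges c3 = {}"
      "set c1 \<inter> set c2 = {a, b}" "set c1 \<inter> set c3 = {a, b}" "set c2 \<inter> set c3 = {a, b}"
    and q: "q1 \<in> set c1 - {a, b}" "q2 \<in> set c2 - {a, b}" "q3 \<in> set c3 - {a, b}"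
    and p: "p \<noteq> q1" "p \<noteq> q2" "p \<noteq> q3"
    and d: "graph_path V E p q1 d1" "graph_path V E p q2 d2" "graph_path V E p q3 d3"
    and disj: "set d1 \<inter> (set c2 \<union> set c3) = {}" "set d2 \<inter> (set c1 \<union> set c3) = {}"
      "set d3 \<inter> (set c1 \<union> set c2) = {}"
  shows False
proof (rule K33_not_in_plane)
  show "bigon (pt a) (pt b) (pc c1) (pc c2)" "bigon (pt a) (pt b) (pc c1) (pc c3)"
    "bigon (pt a) (pt b) (pc c2) (pc c3)"
    using path_curve_bigon c ab dist by blast+
  have mem: "pt r \<in> path_image (pc c) - {pt a, pt b}"
    if "graph_path V E a b c" "r \<in> set c - {a, b}" for r c
  proof -
    have "r \<in> V" "a \<in> V" "b \<in> V" using that by (auto simp: graph_path_def)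
    then show ?thesis using that pt_in_path_curve[OF that(1) ab] pt_eq_iff by auto
  qed
  show "pt q1 \<in> path_image (pc c1) - {pt a, pt b}" "pt q2 \<in> path_image (pc c2) - {pt a, pt b}"
    "pt q3 \<in> path_image (pc c3) - {pt a, pt b}"
    using mem c q by blast+
  have D: "connected (path_image (pc d))" "pt p \<in> path_image (pc d)" "pt r \<in> path_image (pc d)"
    if "graph_path V E p r d" "p \<noteq> r" for r d
  proof -
    note P = path_curve(1-3)[OF that]
    show "connected (path_image (pc d))" using P(1) connected_arc_image by blast
    show "pt p \<in> path_image (pc d)" "pt r \<in> path_image (pc d)"
      using P(2,3) pathstart_in_path_image pathfinish_in_path_image by metis+
  qed
  show "connected (path_image (pc d1))" "pt p \<in> path_image (pc d1)" "pt q1 \<in> path_image (pc d1)"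
    "connected (path_image (pc d2))" "pt p \<in> path_image (pc d2)" "pt q2 \<in> path_image (pc d2)"
    "connected (path_image (pc d3))" "pt p \<in> path_image (pc d3)" "pt q3 \<in> path_image (pc d3)"
    using D d p by blast+
  have J: "path_image (pc d) \<inter> (path_image (pc c) \<union> path_image (pc c')) = {}"
    if "graph_path V E p r d" "p \<noteq> r" "graph_path V E a b c" "graph_path V E a b c'"
      "set d \<inter> (set c \<union> set c') = {}" for r d c c'
    using path_curve_disjoint[OF that(1,2,3) ab] path_curve_disjoint[OF that(1,2,4) ab] that(5) by blast
  show "path_image (pc d1) \<inter> (path_image (pc c2) \<union> path_image (pc c3)) = {}"
    "path_image (pc d2) \<inter> (path_image (pc c1) \<union> path_image (pc c3)) = {}"
    "path_image (pc d3) \<inter> (path_image (pc c1) \<union> path_image (pc c2)) = {}"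
    using J d p c disj by blast+
qed

end

section \<open>The Petersen graph\<close>

text \<open>The vertices \<open>0, \<dots>, 5\<close> form a hexagon, the vertices \<open>6, 7, 8\<close> are the midpoints of its long
  diagonals, and \<open>9\<close> is adjacent to these midpoints.\<close>

definition petersen_arcs :: "(nat \<times> nat) list" where
  "petersen_arcs = [(0,1), (1,2), (2,3), (3,4), (4,5), (0,5), (0,6), (3,6), (1,7), (4,7), (2,8), (5,8),
     (6,9), (7,9), (8,9)]"

text \<open>The symmetric closure of the list is executable, so that the conditions on the ten
  vertices can be decided by evaluation.\<close>

definition petersen_adj :: "nat \<Rightarrow> nat \<Rightarrow> bool" where
  "petersen_adj u v \<longleftrightarrow> (u, v) \<in> set petersen_arcs \<or> (v, u) \<in> set petersen_arcs"

definition petersen_edges :: "nat set set" where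
  "petersen_edges = {{u, v} | u v. petersen_adj u v}"

lemma petersen_edge_iff: "{u, v} \<in> petersen_edges \<longleftrightarrow> petersen_adj u v"
  by (auto simp: petersen_edges_def doubleton_eq_iff petersen_adj_def)

lemma petersen_adjD: "petersen_adj u v \<Longrightarrow> u < 10 \<and> v < 10 \<and> u \<noteq> v"
  by (auto simp: petersen_adj_def petersen_arcs_def)

lemma petersen_triangle_free:
  "\<forall>a\<in>set [0..<10]. \<forall>b\<in>set [0..<10]. \<forall>c\<in>set [0..<10].
     petersen_adj a b \<longrightarrow> petersen_adj b c \<longrightarrow> \<not> petersen_adj a c"
  by code_simp

lemma petersen_common_neighbour:
  "\<forall>u\<in>set [0..<10]. \<forall>v\<in>set [0..<10]. u \<noteq> v \<longrightarrow> \<not> petersen_adj u v \<longrightarrow>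
     (\<exists>w\<in>set [0..<10]. petersen_adj u w \<and> petersen_adj w v \<and>
       (\<forall>w'\<in>set [0..<10]. petersen_adj u w' \<longrightarrow> petersen_adj w' v \<longrightarrow> w' = w))"
  by code_simp

interpretation petersen: triangle_free_geodetic "{..<10}" petersen_edges
proof
  show "simple_graph {..<10} petersen_edges"
    by (auto simp: simple_graph_def petersen_edges_def dest: petersen_adjD)
  show "{a, c} \<notin> petersen_edges" if "{a, b} \<in> petersen_edges" "{b, c} \<in> petersen_edges" for a b c
    using petersen_triangle_free that petersen_adjD[of a b] petersen_adjD[of b c]
    unfolding petersen_edge_iff set_upt atLeastLessThan_iff Ball_def by blast
  show "\<exists>!w. {u, w} \<in> petersen_edges \<and> {w, v} \<in> petersen_edges"
    if "u \<in> {..<10}" "v \<in> {..<10}" "u \<noteq> v" "{u, v} \<notin> petersen_edges" for u v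
  proof -
    have "u \<in> set [0..<10]" "v \<in> set [0..<10]" "\<not> petersen_adj u v"
      using that by (auto simp: petersen_edge_iff)
    from petersen_common_neighbour[rule_format, OF this(1,2) \<open>u \<noteq> v\<close> this(3)]
    obtain w where w: "petersen_adj u w" "petersen_adj w v" "\<forall>w'\<in>set [0..<10].
        petersen_adj u w' \<longrightarrow> petersen_adj w' v \<longrightarrow> w' = w" by blast
    then show ?thesis unfolding petersen_edge_iff using petersen_adjD by (intro ex1I[of _ w]) auto
  qed
qed

lemma petersen_no_philogeodetic_drawing:
  "\<not> philogeodetic_drawing {..<10} petersen_edges pt crv"
proof
  assume "philogeodetic_drawing {..<10} petersen_edges pt crv"
  then interpret philogeodetic_drawing "{..<10}" petersen_edges pt crv .
  have path: "graph_path {..<10} petersen_edges (hd p) (last p) p"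
    if "p \<noteq> []" "set p \<subseteq> {..<10}" "distinct p" "successively petersen_adj p" for p
    using that by (simp add: graph_path_def petersen_edge_iff)
  note adj = petersen_adj_def petersen_arcs_def
  show False
  \<comment> \<open>A hexagon with its three long diagonals is K33, with classes 0, 2, 4 and 1, 3,
    5. Here the diagonals are subdivided by 6, 7 and 8.\<close>
  proof (rule no_K33_subdivision[of 0 2 "[0,1,2]" "[0,6,3,2]" "[0,5,8,2]" 1 3 5 4
        "[4,7,1]" "[4,3]" "[4,5]"])
    show "graph_path {..<10} petersen_edges 0 2 [0,1,2]" using path[of "[0,1,2]"] by (simp add: adj)
    show "graph_path {..<10} petersen_edges 0 2 [0,6,3,2]" using path[of "[0,6,3,2]"] by (simp add: adj)
    show "graph_path {..<10} petersen_edges 0 2 [0,5,8,2]" using path[of "[0,5,8,2]"] by (simp add: adj)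
    show "graph_path {..<10} petersen_edges 4 1 [4,7,1]" using path[of "[4,7,1]"] by (simp add: adj)
    show "graph_path {..<10} petersen_edges 4 3 [4,3]" using path[of "[4,3]"] by (simp add: adj)
    show "graph_path {..<10} petersen_edges 4 5 [4,5]" using path[of "[4,5]"] by (simp add: adj)
  qed (auto simp: doubleton_eq_iff)
qed

theorem theorem3:
  "\<exists>(V :: nat set) E.
     finite V \<and> simple_graph V E \<and> geodetic V E \<and> graph_diameter V E = 2 \<and>
     (\<forall>pt crv. drawing V E pt crv \<longrightarrow>
        (\<exists>P1 P2 u1 v1 u2 v2.
           u1 \<noteq> v1 \<and> shortest_path V E u1 v1 P1 \<and>
           u2 \<noteq> v2 \<and> shortest_path V E u2 v2 P2 \<and>
           P1 \<noteq> P2 \<and> P1 \<noteq> rev P2 \<and>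
           (\<exists>k>1. meet_times (path_curve pt crv P1) (path_curve pt crv P2) k)))"
proof (intro exI[of _ "{..<10}"] exI[of _ petersen_edges] conjI allI impI)
  show "graph_diameter {..<10} petersen_edges = 2"
    by (rule petersen.graph_diameter_eq_2[of 0 2])
      (auto simp: petersen_edge_iff petersen_adj_def petersen_arcs_def)
  fix pt crv assume d: "drawing {..<10} petersen_edges pt crv"
  show "\<exists>P1 P2 u1 v1 u2 v2.
           u1 \<noteq> v1 \<and> shortest_path {..<10} petersen_edges u1 v1 P1 \<and>
           u2 \<noteq> v2 \<and> shortest_path {..<10} petersen_edges u2 v2 P2 \<and>
           P1 \<noteq> P2 \<and> P1 \<noteq> rev P2 \<and>
           (\<exists>k>1. meet_times (path_curve pt crv P1) (path_curve pt crv P2) k)" (is ?goal)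
  proof (rule ccontr)
    assume neg: "\<not> ?goal"
    \<comment> \<open>The assumption of the locale is the instance \<open>k = 2\<close> of the
      negated goal.\<close>
    have "philogeodetic_drawing {..<10} petersen_edges pt crv"
      using d neg one_less_numeral_iff semiring_norm(76)
      by unfold_locales (blast+)
    then show False using petersen_no_philogeodetic_drawing by blast
  qed
qed (simp_all add: petersen.simple petersen.geodetic)

end
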